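(* Let $\theta<0$ and $a>0$. For $\alpha\in\{a,1/a\}$ set $\hat P_{\alpha,\theta}(z):=\sum_{n=0}^\infty p_n^\alpha(\theta)z^n$. Then, as formal power series in $z$, $$\hat P_{a,\theta}(z)=\frac{\hat P_{1/a,\theta}(-z)}{1-z\,\hat P_{1/a,\theta}(-z)}.$$
   Context: For $a\in(-1,\infty)$ and $\theta\in\mathbb R$, let $X_1,X_2,\ldots$ be i.i.d. random variables uniformly distributed on $[-a,1]$. Set $p_0^a(\theta):=1$ and, for $n\ge1$, $$p_n^a(\theta):=\mathbb P(X_2\ge\theta X_1,\,X_3\ge\theta X_2,\,\ldots,\,X_{n+1}\ge\theta X_n).$$ *)

theory Defs
  imports
    "HOL-Probability.Probability"
    "HOL-Computational_Algebra.Formal_Power_Series"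
begin

text \<open>
  The joint law, on sequences indexed by 1, 2, 3, and so on, of i.i.d. random variables that are
  uniformly distributed on the interval from \<open>- a\<close> to 1. It is meaningful for \<open>a > - 1\<close> only:
  otherwise the interval is a null set.
\<close>

definition iid_uniform :: "real \<Rightarrow> (nat \<Rightarrow> real) measure" where
  "iid_uniform a = (\<Pi>\<^sub>M i\<in>{1..}. uniform_measure lborel {- a..1})"

definition persistence_prob :: "real \<Rightarrow> real \<Rightarrow> nat \<Rightarrow> real" where
  "persistence_prob a \<theta> n =
     (if n = 0 then 1
      else \<P>(X in iid_uniform a. \<forall>i\<in>{1..n}. X (Suc i) \<ge> \<theta> * X i))"

definition persistence_fps :: "real \<Rightarrow> real \<Rightarrow> real fps" where
  "persistence_fps a \<theta> = Abs_fps (persistence_prob a \<theta>)"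

lemma prob_space_iid_uniform:
  assumes "a > - 1"
  shows "prob_space (iid_uniform a)"
  unfolding iid_uniform_def
  by (intro prob_space_PiM prob_space_uniform_measure) (use assms in auto)

text \<open>
  The probabilities do not depend on the choice of the underlying probability space.
\<close>

lemma (in prob_space) persistence_prob_eq:
  fixes X :: "nat \<Rightarrow> 'a \<Rightarrow> real"
  assumes a: "a > - 1"
    and indep: "indep_vars (\<lambda>_. borel) X {1..}"
    and unif: "\<And>i. i \<ge> 1 \<Longrightarrow>
      distributed M lborel (X i) (\<lambda>x. indicator {- a..1} x / measure lborel {- a..1})"
    and n: "n \<ge> 1"
  shows "persistence_prob a \<theta> n = \<P>(\<omega> in M. \<forall>i\<in>{1..n}. X (Suc i) \<omega> \<ge> \<theta> * X i \<omega>)"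
proof -
  let ?U = "uniform_measure lborel {- a..1}"
  let ?E = "{x \<in> space (\<Pi>\<^sub>M i\<in>{1..}. borel). \<forall>i\<in>{1..n}. x (Suc i) \<ge> \<theta> * x i}"
  let ?Y = "\<lambda>\<omega>. \<lambda>i\<in>{1..}. X i \<omega>"
  have rv: "random_variable borel (X i)" if "i \<in> {1..}" for i
    using indep that by (auto simp: indep_vars_def)
  have law: "distr M borel (X i) = ?U" if "i \<in> {1..}" for i
  proof -
    have "distr M borel (X i) = distr M lborel (X i)"
      by (rule distr_cong) auto
    also have "\<dots> = density lborel (\<lambda>x. ennreal (indicator {- a..1} x / measure lborel {- a..1}))"
      using unif[of i] that by (simp add: distributed_def)
    also have "\<dots> = ?U"
      unfolding uniform_measure_def
      by (rule density_cong)
         (use a in \<open>auto simp: indicator_def divide_ennreal [symmetric]\<close>)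
    finally show ?thesis .
  qed
  have "(\<Pi>\<^sub>M i\<in>{1..}. distr M borel (X i)) = iid_uniform a"
    unfolding iid_uniform_def by (rule PiM_cong) (use law in auto)
  then have joint: "distr M (\<Pi>\<^sub>M i\<in>{1..}. borel) ?Y = iid_uniform a"
    using indep_vars_iff_distr_eq_PiM'[where I = "{1..}" and M' = "\<lambda>_. borel" and X = X] rv indep by auto
  have sp: "space (iid_uniform a) = space (\<Pi>\<^sub>M i\<in>{1..}. borel)"
    by (simp add: iid_uniform_def space_PiM)
  have meas: "?E \<in> sets (\<Pi>\<^sub>M i\<in>{1..}. borel)"
  proof (rule sets.sets_Collect_finite_All)
    fix i assume "i \<in> {1..n}"
    then have [measurable]:
      "(\<lambda>x. x i) \<in> borel_measurable (\<Pi>\<^sub>M i\<in>{1..}. (borel :: real measure))"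
      "(\<lambda>x. x (Suc i)) \<in> borel_measurable (\<Pi>\<^sub>M i\<in>{1..}. (borel :: real measure))"
      by (auto intro!: measurable_component_singleton)
    show "{x \<in> space (\<Pi>\<^sub>M i\<in>{1..}. borel). x (Suc i) \<ge> \<theta> * x i} \<in> sets (\<Pi>\<^sub>M i\<in>{1..}. borel)"
      by measurable
  qed simp
  have Y: "?Y \<in> measurable M (\<Pi>\<^sub>M i\<in>{1..}. borel)"
    by (rule measurable_restrict) (use rv in auto)
  have "persistence_prob a \<theta> n = measure (iid_uniform a) ?E"
    using n by (simp add: persistence_prob_def sp)
  also have "\<dots> = measure M (?Y -` ?E \<inter> space M)"
    unfolding joint[symmetric] by (rule measure_distr[OF Y meas])
  also have "?Y -` ?E \<inter> space M = {\<omega> \<in> space M. \<forall>i\<in>{1..n}. X (Suc i) \<omega> \<ge> \<theta> * X i \<omega>}"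
    by (auto simp: space_PiM)
  finally show ?thesis .
qed

end

theory Submission
  imports Defs
begin

text \<open>
  Let \<open>X\<^sub>1, X\<^sub>2, \<dots>\<close> be i.i.d. and uniform on \<open>{- a..1}\<close> with \<open>a > 0\<close>. Since \<open>- X\<^sub>i / a\<close> is uniform on
  \<open>{- (1 / a)..1}\<close>, and multiplication by the negative number \<open>- 1 / a\<close> reverses inequalities, the
  persistence probability \<open>q\<^sub>k\<close> for the parameter \<open>1 / a\<close> is the probability that the reversed
  inequalities \<open>X (Suc i) \<le> \<theta> * X i\<close> hold for all \<open>i \<in> {1..k}\<close>
  (lemma \<open>prob_below_eq_persistence_prob\<close>). Let \<open>r\<^sub>k\<close> be the probability that the reversed
  inequalities hold for \<open>i \<in> {1..k}\<close> and the original ones for \<open>i \<in> {Suc k..n}\<close>. Then \<open>r\<^sub>0 = p\<^sub>n\<close>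
  and \<open>r\<^sub>n = q\<^sub>n\<close>, and for \<open>k < n\<close>
  we have \<open>r\<^sub>k + r\<^bsub>k+1\<^esub> = q\<^sub>k * p\<^bsub>n-1-k\<^esub>\<close> (lemma \<open>prob_below_above_step\<close>).
  Indeed, ties \<open>X (Suc i) = \<theta> * X i\<close> have probability 0, so the left-hand side is the probability
  of the event in which the inequality with index \<open>k + 1\<close> is dropped; without it, the remaining
  inequalities split into a group that involves only \<open>X\<^sub>1, \<dots>, X\<^bsub>k+1\<^esub>\<close> and one that involves only
  \<open>X\<^bsub>k+2\<^esub>, \<dots>, X\<^bsub>n+1\<^esub>\<close>, which are independent. The alternating sum over \<open>k\<close> telescopes to
  \<open>p\<^sub>n = (-1) ^ n * q\<^sub>n + (\<Sum>k<n. (-1) ^ k * q\<^sub>k * p\<^bsub>n-1-k\<^esub>)\<close>,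
  which is the coefficient form of \<open>P(z) = Q(-z) + z Q(-z) P(z)\<close> for the generating functions
  \<open>P\<close> of \<open>p\<^sub>n\<close> and \<open>Q\<close> of \<open>q\<^sub>n\<close>.
\<close>

section \<open>Reindexing and rescaling i.i.d. uniform variables\<close>

lemma (in prob_space) indep_vars_reindex:
  assumes indep: "indep_vars M' X I" and inj: "inj_on f J" and sub: "f ` J \<subseteq> I"
  shows "indep_vars (\<lambda>j. M' (f j)) (\<lambda>j. X (f j)) J"
proof -
  let ?F = "\<lambda>i. {X i -` A \<inter> space M |A. A \<in> sets (M' i)}"
  have F: "indep_sets ?F I" and rv: "\<forall>i\<in>I. random_variable (M' i) (X i)"
    using indep by (auto simp: indep_vars_def2)
  have "indep_sets (\<lambda>j. ?F (f j)) J"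
  proof (rule indep_setsI)
    show "?F (f j) \<subseteq> events" if "j \<in> J" for j
      using F sub that unfolding indep_sets_def by blast
  next
    fix A K assume K: "K \<noteq> {}" "K \<subseteq> J" "finite K" and A: "\<forall>j\<in>K. A j \<in> ?F (f j)"
    have injK: "inj_on f K"
      using inj K(2) by (rule inj_on_subset)
    let ?B = "\<lambda>i. A (the_inv_into K f i)"
    have B: "?B (f j) = A j" if "j \<in> K" for j
      using that injK by (simp add: the_inv_into_f_f)
    have "prob (\<Inter>i\<in>f ` K. ?B i) = (\<Prod>i\<in>f ` K. prob (?B i))"
    proof (rule indep_setsD[OF F])
      show "\<forall>i\<in>f ` K. ?B i \<in> ?F i"
        using A B by simp
    qed (use K sub in auto)
    then show "prob (\<Inter>j\<in>K. A j) = (\<Prod>j\<in>K. prob (A j))"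
      using B by (simp add: prod.reindex[OF injK])
  qed
  then show ?thesis
    using rv sub by (auto simp: indep_vars_def2)
qed

lemma (in prob_space) distributed_uniform_scale_neg:
  fixes a :: real
  assumes X: "distributed M lborel X (\<lambda>x. indicator {- a..1} x / measure lborel {- a..1})"
    and a: "a > 0"
  shows "distributed M lborel (\<lambda>\<omega>. - X \<omega> / a)
    (\<lambda>x. indicator {- (1 / a)..1} x / measure lborel {- (1 / a)..1})"
proof -
  let ?f = "\<lambda>x :: real. ennreal (indicator {- a..1} x / measure lborel {- a..1})"
  let ?g = "\<lambda>x :: real. ennreal (indicator {- (1 / a)..1} x / measure lborel {- (1 / a)..1})"
  have "?g x = ?f ((x - 0) / (- (1 / a))) / \<bar>- (1 / a)\<bar>" for x
    using a by (auto simp: divide_ennreal indicator_def field_simps)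
  then have "?g = (\<lambda>x. ?f ((x - 0) / (- (1 / a))) / \<bar>- (1 / a)\<bar>)"
    by blast
  then show ?thesis
    using distributed_affine[OF X, of "- (1 / a)" 0] a by simp
qed

section \<open>Events of an i.i.d. uniform sequence\<close>

text \<open>
  I.i.d. variables \<open>X i\<close> for \<open>i \<ge> 1\<close>, uniform on \<open>{- a..1}\<close>, on an arbitrary probability space; nothing
  is assumed about \<open>X 0\<close>.
\<close>

locale iid_uniform_sequence = prob_space M for M :: "'a measure" +
  fixes X :: "nat \<Rightarrow> 'a \<Rightarrow> real" and a :: real
  assumes a_gt: "a > - 1"
    and indep: "indep_vars (\<lambda>_. borel) X {1..}"
    and unif: "\<And>i. i \<ge> 1 \<Longrightarrow>
      distributed M lborel (X i) (\<lambda>x. indicator {- a..1} x / measure lborel {- a..1})"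
begin

lemma X_measurable: "i \<ge> 1 \<Longrightarrow> X i \<in> borel_measurable M"
  using indep by (auto simp: indep_vars_def)

text \<open>
  The event that the inequality with index \<open>i\<close>, which compares the variables with indices \<open>i\<close> and
  \<open>Suc i\<close>, holds for all \<open>i \<in> I\<close>. It is meant for \<open>I \<subseteq> {1..}\<close>.
\<close>

definition above :: "real \<Rightarrow> nat set \<Rightarrow> 'a set" where
  "above \<theta> I = {\<omega> \<in> space M. \<forall>i\<in>I. X (Suc i) \<omega> \<ge> \<theta> * X i \<omega>}"

text \<open>
  The event that the reversed inequalities hold. Both are weak, so \<open>above \<theta> {i}\<close> and \<open>below \<theta> {i}\<close>
  cover the space but overlap in the ties.
\<close>

definition below :: "real \<Rightarrow> nat set \<Rightarrow> 'a set" where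
  "below \<theta> I = {\<omega> \<in> space M. \<forall>i\<in>I. X (Suc i) \<omega> \<le> \<theta> * X i \<omega>}"

lemma above_events: "finite I \<Longrightarrow> I \<subseteq> {1..} \<Longrightarrow> above \<theta> I \<in> events"
  unfolding above_def
proof (intro sets.sets_Collect_finite_All)
  fix i assume "I \<subseteq> {1..}" "i \<in> I"
  then have [measurable]: "X i \<in> borel_measurable M" "X (Suc i) \<in> borel_measurable M"
    by (auto intro!: X_measurable)
  show "{\<omega> \<in> space M. X (Suc i) \<omega> \<ge> \<theta> * X i \<omega>} \<in> events"
    by measurable
qed

lemma below_events: "finite I \<Longrightarrow> I \<subseteq> {1..} \<Longrightarrow> below \<theta> I \<in> events"
  unfolding below_def
proof (intro sets.sets_Collect_finite_All)
  fix i assume "I \<subseteq> {1..}" "i \<in> I"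
  then have [measurable]: "X i \<in> borel_measurable M" "X (Suc i) \<in> borel_measurable M"
    by (auto intro!: X_measurable)
  show "{\<omega> \<in> space M. X (Suc i) \<omega> \<le> \<theta> * X i \<omega>} \<in> events"
    by measurable
qed

text \<open>Stationarity: only the number of consecutive inequalities matters.\<close>

lemma prob_above_eq_persistence_prob:
  "prob (above \<theta> {Suc k..k + n}) = persistence_prob a \<theta> n"
proof (cases "n = 0")
  case True
  then show ?thesis
    by (simp add: above_def persistence_prob_def prob_space)
next
  case False
  have "indep_vars (\<lambda>_. borel) (\<lambda>i. X (i + k)) {1..}"
    by (rule indep_vars_reindex[OF indep]) auto
  then have "persistence_prob a \<theta> n =
      \<P>(\<omega> in M. \<forall>i\<in>{1..n}. X (Suc i + k) \<omega> \<ge> \<theta> * X (i + k) \<omega>)"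
    by (rule persistence_prob_eq[OF a_gt]) (use unif False in auto)
  also have "{\<omega> \<in> space M. \<forall>i\<in>{1..n}. X (Suc i + k) \<omega> \<ge> \<theta> * X (i + k) \<omega>} =
      above \<theta> ((\<lambda>i. i + k) ` {1..n})"
    unfolding above_def add_Suc by blast
  also have "(\<lambda>i. i + k) ` {1..n} = {Suc k..k + n}"
    by (simp add: add.commute)
  finally show ?thesis
    by simp
qed

lemma prob_below_eq_persistence_prob:
  assumes a: "a > 0"
  shows "prob (below \<theta> {1..n}) = persistence_prob (1 / a) \<theta> n"
proof (cases "n = 0")
  case True
  then show ?thesis
    by (simp add: below_def persistence_prob_def prob_space)
next
  case False
  have "1 / a > - 1"
    using a by (simp add: field_simps)
  moreover have "indep_vars (\<lambda>_. borel) (\<lambda>i \<omega>. - X i \<omega> / a) {1..}"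
    by (rule indep_vars_compose2[OF indep, where Y = "\<lambda>_ x. - x / a"]) simp
  ultimately have "persistence_prob (1 / a) \<theta> n =
      \<P>(\<omega> in M. \<forall>i\<in>{1..n}. - X (Suc i) \<omega> / a \<ge> \<theta> * (- X i \<omega> / a))"
    by (rule persistence_prob_eq)
       (use distributed_uniform_scale_neg[OF unif a] False in auto)
  also have "{\<omega> \<in> space M. \<forall>i\<in>{1..n}. - X (Suc i) \<omega> / a \<ge> \<theta> * (- X i \<omega> / a)} = below \<theta> {1..n}"
    using a by (simp add: below_def divide_le_cancel)
  finally show ?thesis
    by simp
qed

text \<open>
  Given the value of \<open>X i\<close>, a tie pins the independent variable \<open>X (Suc i)\<close>, whose law has no atoms,
  to a single point.
\<close>

lemma AE_no_tie:
  assumes i: "i \<ge> 1"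
  shows "AE \<omega> in M. X (Suc i) \<omega> \<noteq> \<theta> * X i \<omega>"
proof -
  let ?D = "\<lambda>i. distr M borel (X i)"
  have [measurable]: "X i \<in> borel_measurable M" "X (Suc i) \<in> borel_measurable M"
    using i by (auto intro!: X_measurable)
  have law: "?D j = density lborel (\<lambda>x. ennreal (indicator {- a..1} x / measure lborel {- a..1}))"
    if "j \<ge> 1" for j
  proof -
    have "?D j = distr M lborel (X j)"
      by (rule distr_cong) auto
    then show ?thesis
      using unif[OF that] by (simp add: distributed_def)
  qed
  have no_atoms: "AE y in ?D (Suc i). y \<noteq> c" for c
    unfolding law[of "Suc i", simplified]
    by (subst AE_density) (use AE_lborel_singleton[of c] in \<open>auto elim!: eventually_mono\<close>)
  interpret D: pair_prob_space "?D i" "?D (Suc i)"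
    by (intro pair_prob_space.intro pair_sigma_finite.intro prob_space_distr
        prob_space_imp_sigma_finite) auto
  have "indep_var borel (X i) borel (X (Suc i))"
  proof -
    have "inj_on (case_bool i (Suc i)) UNIV"
      by (auto simp: inj_on_def split: bool.splits)
    then have "indep_vars (\<lambda>_. borel) (\<lambda>b. X (case_bool i (Suc i) b)) UNIV"
      by (rule indep_vars_reindex[OF indep]) (use i in \<open>auto split: bool.splits\<close>)
    then show ?thesis
      unfolding indep_var_def
      by (rule indep_vars_cong[THEN iffD1, rotated -1]) (auto split: bool.splits)
  qed
  then have joint: "?D i \<Otimes>\<^sub>M ?D (Suc i) = distr M (borel \<Otimes>\<^sub>M borel) (\<lambda>\<omega>. (X i \<omega>, X (Suc i) \<omega>))"
    by (simp add: indep_var_distribution_eq)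
  have "AE z in ?D i \<Otimes>\<^sub>M ?D (Suc i). snd z \<noteq> \<theta> * fst z"
  proof (rule D.AE_pair_measure)
    have "{z \<in> space (borel \<Otimes>\<^sub>M borel). snd z \<noteq> \<theta> * fst z} \<in> sets (borel \<Otimes>\<^sub>M (borel :: real measure))"
      by measurable
    then show "{z \<in> space (?D i \<Otimes>\<^sub>M ?D (Suc i)). snd z \<noteq> \<theta> * fst z} \<in> sets (?D i \<Otimes>\<^sub>M ?D (Suc i))"
      by (simp add: space_pair_measure cong: sets_pair_measure_cong)
  qed (use no_atoms in simp)
  then show ?thesis
    unfolding joint by (subst (asm) AE_distr_iff) auto
qed

text \<open>
  The index \<open>Suc k\<close> is missing on both sides, so the two events depend on the disjoint groups of
  variables with indices in \<open>{1..Suc k}\<close> and in \<open>{Suc (Suc k)..Suc n}\<close>.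
\<close>

lemma indep_below_above:
  assumes "k < n"
  shows "prob (below \<theta> {1..k} \<inter> above \<theta> {Suc (Suc k)..n}) =
    prob (below \<theta> {1..k}) * prob (above \<theta> {Suc (Suc k)..n})"
proof -
  let ?A = "{1..Suc k}" and ?B = "{Suc (Suc k)..Suc n}"
  let ?X = "\<lambda>I \<omega>. restrict (\<lambda>i. X i \<omega>) I"
  let ?P = "\<lambda>I. PiM I (\<lambda>_. borel :: real measure)"
  let ?E = "{x \<in> space (?P ?A). \<forall>i\<in>{1..k}. x (Suc i) \<le> \<theta> * x i}"
  let ?F = "{x \<in> space (?P ?B). \<forall>i\<in>{Suc (Suc k)..n}. x (Suc i) \<ge> \<theta> * x i}"
  have "indep_var (?P ?A) (?X ?A) (?P ?B) (?X ?B)"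
    by (rule indep_var_restrict[OF indep]) auto
  moreover have "?E \<in> sets (?P ?A)"
  proof (rule sets.sets_Collect_finite_All)
    fix i assume "i \<in> {1..k}"
    then have [measurable]: "(\<lambda>x. x i) \<in> borel_measurable (?P ?A)"
      "(\<lambda>x. x (Suc i)) \<in> borel_measurable (?P ?A)"
      by (auto intro!: measurable_component_singleton)
    show "{x \<in> space (?P ?A). x (Suc i) \<le> \<theta> * x i} \<in> sets (?P ?A)"
      by measurable
  qed simp
  moreover have "?F \<in> sets (?P ?B)"
  proof (rule sets.sets_Collect_finite_All)
    fix i assume "i \<in> {Suc (Suc k)..n}"
    then have [measurable]: "(\<lambda>x. x i) \<in> borel_measurable (?P ?B)"
      "(\<lambda>x. x (Suc i)) \<in> borel_measurable (?P ?B)"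
      by (auto intro!: measurable_component_singleton)
    show "{x \<in> space (?P ?B). x (Suc i) \<ge> \<theta> * x i} \<in> sets (?P ?B)"
      by measurable
  qed simp
  ultimately have "prob ((\<lambda>\<omega>. (?X ?A \<omega>, ?X ?B \<omega>)) -` (?E \<times> ?F) \<inter> space M) =
      prob (?X ?A -` ?E \<inter> space M) * prob (?X ?B -` ?F \<inter> space M)"
    by (rule indep_varD)
  moreover have E: "?X ?A -` ?E \<inter> space M = below \<theta> {1..k}"
    by (auto simp: below_def space_PiM)
  moreover have F: "?X ?B -` ?F \<inter> space M = above \<theta> {Suc (Suc k)..n}"
    by (auto simp: above_def space_PiM)
  moreover have "(\<lambda>\<omega>. (?X ?A \<omega>, ?X ?B \<omega>)) -` (?E \<times> ?F) \<inter> space M =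
      (?X ?A -` ?E \<inter> space M) \<inter> (?X ?B -` ?F \<inter> space M)"
    by blast
  ultimately show ?thesis
    by simp
qed

section \<open>The recurrence\<close>

lemma prob_below_above_step:
  assumes "a > 0" and kn: "k < n"
  shows "prob (below \<theta> {1..k} \<inter> above \<theta> {Suc k..n}) +
      prob (below \<theta> {1..Suc k} \<inter> above \<theta> {Suc (Suc k)..n}) =
    persistence_prob (1 / a) \<theta> k * persistence_prob a \<theta> (n - 1 - k)"
proof -
  let ?L = "below \<theta> {1..k} \<inter> above \<theta> {Suc k..n}"
  let ?R = "below \<theta> {1..Suc k} \<inter> above \<theta> {Suc (Suc k)..n}"
  have "{Suc k..n} = insert (Suc k) {Suc (Suc k)..n}" "{1..Suc k} = insert (Suc k) {1..k}"
    using kn by auto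
  then have union: "?L \<union> ?R = below \<theta> {1..k} \<inter> above \<theta> {Suc (Suc k)..n}"
    and tie: "\<And>\<omega>. \<omega> \<in> ?L \<inter> ?R \<Longrightarrow> X (Suc (Suc k)) \<omega> = \<theta> * X (Suc k) \<omega>"
    by (auto simp: below_def above_def)
  have "AE \<omega> in M. X (Suc (Suc k)) \<omega> \<noteq> \<theta> * X (Suc k) \<omega>"
    by (rule AE_no_tie) simp
  then have "AE \<omega> in M. \<omega> \<notin> ?L \<or> \<omega> \<notin> ?R"
    by eventually_elim (use tie in blast)
  then have "prob ?L + prob ?R = prob (?L \<union> ?R)"
    by (intro measure_Un_AE[symmetric])
       (auto simp: fmeasurable_eq_sets intro!: sets.Int below_events above_events)
  also have "\<dots> = prob (below \<theta> {1..k}) * prob (above \<theta> {Suc (Suc k)..n})"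
    unfolding union by (rule indep_below_above[OF kn])
  also have "prob (above \<theta> {Suc (Suc k)..n}) = persistence_prob a \<theta> (n - 1 - k)"
    using prob_above_eq_persistence_prob[of \<theta> "Suc k" "n - 1 - k"] kn by simp
  also have "prob (below \<theta> {1..k}) = persistence_prob (1 / a) \<theta> k"
    by (rule prob_below_eq_persistence_prob[OF \<open>a > 0\<close>])
  finally show ?thesis .
qed

lemma persistence_prob_recurrence:
  assumes "a > 0"
  shows "persistence_prob a \<theta> n = (-1) ^ n * persistence_prob (1 / a) \<theta> n +
    (\<Sum>k<n. (-1) ^ k * persistence_prob (1 / a) \<theta> k * persistence_prob a \<theta> (n - 1 - k))"
proof -
  define r where "r k = prob (below \<theta> {1..k} \<inter> above \<theta> {Suc k..n})" for k
  have "(\<Sum>k<n. (-1) ^ k * persistence_prob (1 / a) \<theta> k * persistence_prob a \<theta> (n - 1 - k)) =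
      (\<Sum>k<n. (-1) ^ k * r k - (-1) ^ Suc k * r (Suc k))"
  proof (rule sum.cong[OF refl])
    fix k assume "k \<in> {..<n}"
    then have "r k + r (Suc k) = persistence_prob (1 / a) \<theta> k * persistence_prob a \<theta> (n - 1 - k)"
      unfolding r_def by (intro prob_below_above_step assms) simp
    then show "(-1) ^ k * persistence_prob (1 / a) \<theta> k * persistence_prob a \<theta> (n - 1 - k) =
        (-1) ^ k * r k - (-1) ^ Suc k * r (Suc k)"
      by (simp add: mult.assoc flip: distrib_left)
  qed
  also have "\<dots> = r 0 - (-1) ^ n * r n"
    using sum_lessThan_telescope'[of "\<lambda>k. (-1) ^ k * r k" n] by simp
  also have "r 0 = persistence_prob a \<theta> n"
    using prob_above_eq_persistence_prob[of \<theta> 0 n]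
    by (simp add: r_def below_def above_def Int_def conj_ac cong: conj_cong)
  also have "r n = persistence_prob (1 / a) \<theta> n"
    using prob_below_eq_persistence_prob[OF assms, of \<theta> n]
    by (simp add: r_def below_def above_def Int_def conj_ac cong: conj_cong)
  finally show ?thesis
    by simp
qed

end

lemma iid_uniform_sequence_coordinates:
  assumes "a > - 1"
  shows "iid_uniform_sequence (iid_uniform a) (\<lambda>i \<omega>. \<omega> i) a"
proof -
  let ?U = "uniform_measure lborel {- a..1}"
  interpret prob_space "iid_uniform a"
    using assms by (rule prob_space_iid_uniform)
  have U: "prob_space ?U"
    by (rule prob_space_uniform_measure) (use assms in auto)
  have rv: "(\<lambda>\<omega>. \<omega> i) \<in> borel_measurable (iid_uniform a)" if "i \<ge> 1" for i
  proof -
    have "(\<lambda>\<omega>. \<omega> i) \<in> measurable (iid_uniform a) ?U"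
      unfolding iid_uniform_def using that by (intro measurable_component_singleton) simp
    then show ?thesis
      by (simp cong: measurable_cong_sets)
  qed
  have law: "distr (iid_uniform a) N (\<lambda>\<omega>. \<omega> i) = ?U"
    if "i \<ge> 1" "sets N = sets borel" for N i
  proof -
    have "distr (iid_uniform a) N (\<lambda>\<omega>. \<omega> i) = distr (iid_uniform a) ?U (\<lambda>\<omega>. \<omega> i)"
      by (rule distr_cong) (use that in auto)
    also have "\<dots> = ?U"
      unfolding iid_uniform_def by (rule distr_PiM_component) (use U that in auto)
    finally show ?thesis .
  qed
  show ?thesis
  proof (unfold_locales)
    show "a > - 1" by fact
    have "distr (iid_uniform a) (\<Pi>\<^sub>M i\<in>{1..}. borel) (\<lambda>\<omega>. \<lambda>i\<in>{1..}. \<omega> i) =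
        distr (iid_uniform a) (iid_uniform a) (\<lambda>\<omega>. \<omega>)"
    proof (rule distr_cong)
      show "sets (\<Pi>\<^sub>M i\<in>{1..}. borel) = sets (iid_uniform a)"
        unfolding iid_uniform_def by (rule sets_PiM_cong) auto
    qed (auto simp: iid_uniform_def space_PiM PiE_def extensional_restrict)
    also have "\<dots> = (\<Pi>\<^sub>M i\<in>{1..}. distr (iid_uniform a) borel (\<lambda>\<omega>. \<omega> i))"
      unfolding distr_id by (subst iid_uniform_def, rule PiM_cong) (simp_all add: law)
    finally show "indep_vars (\<lambda>_. borel) (\<lambda>i \<omega>. \<omega> i) {1..}"
      by (subst indep_vars_iff_distr_eq_PiM') (use rv in auto)
  next
    fix i :: nat assume i: "i \<ge> 1"
    have "?U = density lborel (\<lambda>x. ennreal (indicator {- a..1} x / measure lborel {- a..1}))"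
      unfolding uniform_measure_def
      by (rule density_cong)
         (use assms in \<open>auto simp: indicator_def divide_ennreal [symmetric]\<close>)
    then show "distributed (iid_uniform a) lborel (\<lambda>\<omega>. \<omega> i)
        (\<lambda>x. indicator {- a..1} x / measure lborel {- a..1})"
      using rv[OF i] law[OF i, of lborel] by (simp add: distributed_def)
  qed
qed

theorem corollary1:
  fixes a \<theta> :: real
  assumes "\<theta> < 0" and "a > 0"
  shows "persistence_fps a \<theta> =
    (persistence_fps (1 / a) \<theta> oo (- fps_X)) /
    (1 - fps_X * (persistence_fps (1 / a) \<theta> oo (- fps_X)))"
proof -
  define P where "P = persistence_fps a \<theta>"
  define Q where "Q = persistence_fps (1 / a) \<theta> oo (- fps_X)"
  have P: "fps_nth P n = persistence_prob a \<theta> n" for n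
    by (simp add: P_def persistence_fps_def)
  have Q: "fps_nth Q n = (-1) ^ n * persistence_prob (1 / a) \<theta> n" for n
    by (simp add: Q_def persistence_fps_def fps_compose_uminus')
  interpret iid_uniform_sequence "iid_uniform a" "\<lambda>i \<omega>. \<omega> i" a
    by (rule iid_uniform_sequence_coordinates) (use \<open>a > 0\<close> in simp)
  have "P = Q + fps_X * (Q * P)"
  proof (rule fps_ext)
    fix n
    show "fps_nth P n = fps_nth (Q + fps_X * (Q * P)) n"
    proof (cases n)
      case 0
      then show ?thesis
        using persistence_prob_recurrence[OF \<open>a > 0\<close>, of \<theta> 0] by (simp add: P Q)
    next
      case (Suc m)
      then show ?thesis
        using persistence_prob_recurrence[OF \<open>a > 0\<close>, of \<theta> n]
        by (simp add: P Q fps_mult_nth[of Q P] lessThan_Suc_atMost atLeast0AtMost)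
    qed
  qed
  then have PQ: "P * (1 - fps_X * Q) = Q"
    by (simp add: algebra_simps)
  have "fps_nth (1 - fps_X * Q) 0 = 1"
    by simp
  then have "1 - fps_X * Q \<noteq> 0"
    by fastforce
  then have "P = Q / (1 - fps_X * Q)"
    using PQ by (metis nonzero_mult_div_cancel_right)
  then show ?thesis
    unfolding P_def Q_def .
qed

end
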